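(* Let $N\ge 1$, let $\mathbb{F}$ be $\mathbb{R}$ or $\mathbb{C}$, and for invertible $N\times N$ matrices $\bm{X}$ over $\mathbb{F}$ having no eigenvalues in the closed negative real line $(-\infty,0]$ define $$F(\bm{X})=\operatorname{tr}(\bm{X}\operatorname{Log}\bm{X}-\bm{X}),$$ where $\operatorname{Log}$ is the principal matrix logarithm. Then for all such matrices $\bm{X},\bm{Y}$ the total Bregman divergence associated with $F$ (called the total von Neumann divergence) is $$\delta_F(\bm{X},\bm{Y})=\frac{\operatorname{tr}\left(\bm{X}(\operatorname{Log}\bm{X}-\operatorname{Log}\bm{Y})-\bm{X}+\bm{Y}\right)}{\sqrt{1+\|(\operatorname{Log}\bm{Y})^{\mathrm H}\|^2}}.$$
   Context: The principal logarithm $\operatorname{Log}\bm{X}$ of an invertible matrix $\bm{X}$ with no eigenvalues in $(-\infty,0]$ is the unique logarithm of $\bm{X}$ whose eigenvalues lie in the strip $\{z\in\mathbb{C}\mid -\pi<\operatorname{Im}(z)<\pi\}$. The Frobenius inner product is $\langle \bm{X},\bm{Y}\rangle=\operatorname{tr}(\bm{X}^{\mathrm H}\bm{Y})$, where $\bm{X}^{\mathrm H}$ is the conjugate transpose (the transpose in the real case), and $\|\bm{X}\|=\sqrt{\langle \bm{X},\bm{X}\rangle}$. The gradient $\nabla F(\bm{X})$ is the matrix determined by $\langle\nabla F(\bm{X}),\bm{V}\rangle=\frac{d}{d\varepsilon}\big|_{\varepsilon=0}F(\bm{X}+\varepsilon\bm{V})$ ($\varepsilon$ real) for all $N\times N$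 matrices $\bm{V}$ over $\mathbb{F}$. The total Bregman divergence (TBD) associated with $F$ is $$\delta_F(\bm{X},\bm{Y})=\frac{F(\bm{X})-F(\bm{Y})-\langle \nabla F(\bm{Y}),\bm{X}-\bm{Y}\rangle}{\sqrt{1+\|\nabla F(\bm{Y})\|^2}}.$$ *)

theory Defs
  imports "HOL-Analysis.Analysis"
begin

text \<open>
  A matrix over the scalar field \<open>K\<close>, where \<open>K\<close> is \<open>\<real>\<close> or \<open>UNIV\<close>, is a complex matrix with all
  entries in \<open>K\<close>. Treating real matrices as a subset of the complex ones gives a single notion of
  logarithm and (complex) spectrum for both fields; \<open>K\<close> only affects where matrices, directions and
  gradients range.
\<close>

definition mats_over :: "complex set \<Rightarrow> (complex ^ 'n ^ 'n) set" where
  "mats_over K = {A. \<forall>i j. A $ i $ j \<in> K}"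

definition ctranspose :: "complex ^ 'n ^ 'm \<Rightarrow> complex ^ 'm ^ 'n" where
  "ctranspose A = (\<chi> i j. cnj (A $ j $ i))"

definition frob_inner :: "complex ^ 'n ^ 'n \<Rightarrow> complex ^ 'n ^ 'n \<Rightarrow> complex" where
  "frob_inner A B = trace (ctranspose A ** B)"

text \<open>\<open>frob_inner A A\<close> is always a nonnegative real, so taking \<open>Re\<close> loses nothing.\<close>

definition frob_norm :: "complex ^ 'n ^ 'n \<Rightarrow> real" where
  "frob_norm A = sqrt (Re (frob_inner A A))"

definition eigenvalue :: "complex ^ 'n ^ 'n \<Rightarrow> complex \<Rightarrow> bool" where
  "eigenvalue A z \<longleftrightarrow> (\<exists>v. v \<noteq> 0 \<and> A *v v = z *s v)"

text \<open>
  The library's \<open>*\<close> and \<open>^\<close> on vectors act componentwise, so powers are iterated matrix products.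
\<close>

definition matrix_exp :: "complex ^ 'n ^ 'n \<Rightarrow> complex ^ 'n ^ 'n" where
  "matrix_exp A = (\<Sum>k. (1 / fact k) *\<^sub>R (((**) A ^^ k) (mat 1)))"

definition matrix_Log :: "complex ^ 'n ^ 'n \<Rightarrow> complex ^ 'n ^ 'n" where
  "matrix_Log A =
    (THE L. matrix_exp L = A \<and> (\<forall>z. eigenvalue L z \<longrightarrow> - pi < Im z \<and> Im z < pi))"

definition Log_domain :: "complex set \<Rightarrow> (complex ^ 'n ^ 'n) set" where
  "Log_domain K = {A \<in> mats_over K. invertible A \<and> (\<forall>z. eigenvalue A z \<longrightarrow> z \<notin> \<real>\<^sub>\<le>\<^sub>0)}"

definition gradient ::
  "complex set \<Rightarrow> (complex ^ 'n ^ 'n \<Rightarrow> complex) \<Rightarrow> complex ^ 'n ^ 'n \<Rightarrow> complex ^ 'n ^ 'n" where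
  "gradient K F A =
    (THE G. G \<in> mats_over K \<and>
      (\<forall>V \<in> mats_over K.
        ((\<lambda>\<epsilon>::real. F (A + \<epsilon> *\<^sub>R V)) has_vector_derivative frob_inner G V) (at 0)))"

definition total_bregman_divergence ::
  "complex set \<Rightarrow> (complex ^ 'n ^ 'n \<Rightarrow> complex) \<Rightarrow> complex ^ 'n ^ 'n \<Rightarrow> complex ^ 'n ^ 'n \<Rightarrow> complex"
  where
  "total_bregman_divergence K F A B =
    (F A - F B - frob_inner (gradient K F B) (A - B)) /
      complex_of_real (sqrt (1 + (frob_norm (gradient K F B))\<^sup>2))"

definition von_Neumann :: "complex ^ 'n ^ 'n \<Rightarrow> complex" where
  "von_Neumann A = trace (A ** matrix_Log A - A)"

end

theory Submission
  imports Defs "HOL-Computational_Algebra.Fundamental_Theorem_Algebra"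
begin

text \<open>
  The point is that the gradient of \<open>F\<close> at \<open>Y\<close> is \<open>(Log Y)\<^sup>H\<close>; the formula is then linear algebra.
  The principal logarithm is \<open>Log A = \<integral>\<^sub>0\<^sup>1 (A - I) R\<^sub>t dt\<close> with \<open>R\<^sub>t = (I + t (A - I))\<^sup>-\<^sup>1\<close>: the integral
  exponentiates to \<open>A\<close>, maps an eigenvector of \<open>A\<close> for \<open>a\<close> to one for \<open>Ln a\<close>, and agrees with any
  other logarithm \<open>M\<close> in the strip, because the two commute and their difference \<open>D\<close> has
  \<open>exp D = I\<close> and spectrum \<open>{0}\<close>, whence \<open>D = 0\<close>.
  Differentiating \<open>tr (A Log A)\<close> under the integral in direction \<open>V\<close> gives, by cyclicity of the trace,
  \<open>tr (V Log A) + \<integral>\<^sub>0\<^sup>1 tr (V (d/dt) (t A R\<^sub>t)) dt = tr (V Log A) + tr V\<close>,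
  and the term \<open>- tr A\<close> of \<open>F\<close> cancels \<open>tr V\<close>. No derivative of \<open>Log\<close> itself is needed.
\<close>

section \<open>The Banach algebra of bounded operators\<close>

text \<open>
  The type of square matrices is not a Banach algebra for \<open>**\<close>, so the library's \<open>exp\<close> is not available
  for it. A copy of the bounded operators with composition as multiplication is one.
\<close>

typedef (overloaded) 'a bop = "UNIV :: ('a::real_normed_vector \<Rightarrow>\<^sub>L 'a) set" by simp

setup_lifting type_definition_bop

lift_definition bop_apply :: "'a::real_normed_vector bop \<Rightarrow> 'a \<Rightarrow> 'a" is blinfun_apply .

instantiation bop :: (euclidean_space) real_normed_algebra_1
begin

lift_definition zero_bop :: "'a bop" is 0 .
lift_definition one_bop :: "'a bop" is id_blinfun .
lift_definition plus_bop :: "'a bop \<Rightarrow> 'a bop \<Rightarrow> 'a bop" is "(+)" .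
lift_definition minus_bop :: "'a bop \<Rightarrow> 'a bop \<Rightarrow> 'a bop" is "(-)" .
lift_definition uminus_bop :: "'a bop \<Rightarrow> 'a bop" is uminus .
lift_definition times_bop :: "'a bop \<Rightarrow> 'a bop \<Rightarrow> 'a bop" is "(o\<^sub>L)" .
lift_definition scaleR_bop :: "real \<Rightarrow> 'a bop \<Rightarrow> 'a bop" is scaleR .
lift_definition norm_bop :: "'a bop \<Rightarrow> real" is norm .

definition "dist_bop (x::'a bop) y = norm (x - y)"
definition "sgn_bop (x::'a bop) = scaleR (inverse (norm x)) x"
definition [code del]:
  "(uniformity :: ('a bop \<times> 'a bop) filter) = (INF e\<in>{0<..}. principal {(x, y). dist x y < e})"
definition open_bop :: "'a bop set \<Rightarrow> bool" where [code del]: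
  "open_bop U = (\<forall>x\<in>U. \<forall>\<^sub>F (x', y) in uniformity. x' = x \<longrightarrow> y \<in> U)"

instance
proof
  show "norm (x + y) \<le> norm x + norm y" for x y :: "'a bop"
    by transfer (rule norm_triangle_ineq)
  show "norm (x * y) \<le> norm x * norm y" for x y :: "'a bop"
    by transfer (rule norm_blinfun_compose)
  show "(0 :: 'a bop) \<noteq> 1"
  proof transfer
    have "norm (id_blinfun :: 'a \<Rightarrow>\<^sub>L 'a) \<noteq> 0" by simp
    then show "(0 :: 'a \<Rightarrow>\<^sub>L 'a) \<noteq> id_blinfun" by (metis norm_zero)
  qed
qed (rule dist_bop_def sgn_bop_def uniformity_bop_def open_bop_def |
     (transfer, force intro!: blinfun_eqI simp: blinfun.bilinear_simps algebra_simps))+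

end

instance bop :: (euclidean_space) banach
proof
  fix X :: "nat \<Rightarrow> 'a bop"
  assume "Cauchy X"
  then have "Cauchy (\<lambda>n. Rep_bop (X n))"
    by (simp add: Cauchy_def dist_norm norm_bop.rep_eq minus_bop.rep_eq)
  then obtain L where L: "(\<lambda>n. Rep_bop (X n)) \<longlonglongrightarrow> L"
    using Cauchy_convergent convergent_def by blast
  then have "X \<longlonglongrightarrow> Abs_bop L"
    by (simp add: LIMSEQ_def dist_norm norm_bop.rep_eq minus_bop.rep_eq Abs_bop_inverse)
  then show "convergent X" by (rule convergentI)
qed

lemma bop_eqI: "(\<And>v. bop_apply f v = bop_apply g v) \<Longrightarrow> f = g"
  by transfer (rule blinfun_eqI)

lemma bop_apply_simps [simp]:
  fixes f g :: "'a::euclidean_space bop"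
  shows "bop_apply (f + g) v = bop_apply f v + bop_apply g v"
    "bop_apply (f - g) v = bop_apply f v - bop_apply g v"
    "bop_apply (c *\<^sub>R f) v = c *\<^sub>R bop_apply f v"
    "bop_apply (f * g) v = bop_apply f (bop_apply g v)"
    "bop_apply 1 v = v"
  by (transfer, simp add: blinfun.bilinear_simps)+

lemma bounded_linear_bop_apply:
  "bounded_linear (\<lambda>f :: 'a::euclidean_space bop. bop_apply f v)"
proof (rule bounded_linear_intro)
  show "norm (bop_apply f v) \<le> norm f * norm v" for f :: "'a bop"
    by transfer (rule norm_blinfun)
qed simp_all

section \<open>Exponentials in a Banach algebra\<close>

text \<open>The tail of the series from degree 2 on is dominated termwise by that of the real
  exponential at \<open>norm x\<close>, so the real estimate carries over.\<close>

lemma norm_exp_minus_one_minus_le: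
  fixes x :: "'a::{real_normed_algebra_1,banach}"
  assumes "norm x \<le> 1"
  shows "norm (exp x - 1 - x) \<le> (norm x)\<^sup>2"
proof -
  have summ: "summable (\<lambda>n. inverse (fact (n + 2)) * norm x ^ (n + 2))"
    using summable_exp_generic[of "norm x"]
    by (subst summable_iff_shift[where f = "\<lambda>n. inverse (fact n) * norm x ^ n"]) simp
  have "norm (exp x - 1 - x) = norm (\<Sum>n. inverse (fact (n + 2)) *\<^sub>R x ^ (n + 2))"
    by (subst exp_first_two_terms) simp
  also have "\<dots> \<le> (\<Sum>n. inverse (fact (n + 2)) * norm x ^ (n + 2))"
    by (rule norm_suminf_le[OF _ summ]) (simp add: norm_power_ineq mult_left_mono del: power_Suc add_2_eq_Suc')
  also have "\<dots> = exp (norm x) - 1 - norm x"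
    by (subst exp_first_two_terms) simp
  also have "\<dots> \<le> (norm x)\<^sup>2"
    using exp_bound[of "norm x"] assms by simp
  finally show ?thesis .
qed

lemma exp_has_derivative_at_0:
  "(exp has_derivative (\<lambda>h. h)) (at (0 :: 'a::{real_normed_algebra_1,banach}))"
proof (rule has_derivativeI_sandwich[where e = 1 and H = norm])
  fix y :: 'a assume y: "y \<noteq> 0" "dist y 0 < 1"
  then have "norm (exp y - 1 - y) \<le> norm y * norm y"
    using norm_exp_minus_one_minus_le[of y] by (simp add: power2_eq_square)
  then show "norm (exp y - exp 0 - (y - 0)) / norm (y - 0) \<le> norm y"
    using y by (simp add: divide_le_eq)
qed (auto intro: bounded_linear_ident tendsto_eq_intros)

text \<open>As \<open>f s\<close> commutes with \<open>f t\<close>,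
  \<open>exp (f s) = exp (f t) * exp (f s - f t)\<close>, and the derivative of \<open>exp\<close>
  at \<open>0\<close> suffices. Without commutation the formula fails in general.\<close>

lemma exp_has_vector_derivative_commuting:
  fixes f :: "real \<Rightarrow> 'a::{real_normed_algebra_1,banach}"
  assumes f: "(f has_vector_derivative f') (at t within S)" and "t \<in> S"
    and comm: "\<And>s. s \<in> S \<Longrightarrow> f s * f t = f t * f s"
  shows "((\<lambda>s. exp (f s)) has_vector_derivative exp (f t) * f') (at t within S)"
proof -
  have "((\<lambda>s. f s - f t) has_derivative (\<lambda>h. h *\<^sub>R f')) (at t within S)"
    using f by (auto simp: has_vector_derivative_def intro!: derivative_eq_intros)
  from has_derivative_compose[OF this, of exp "\<lambda>h. h"]
  have "((\<lambda>s. exp (f s - f t)) has_derivative (\<lambda>h. h *\<^sub>R f')) (at t within S)"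
    using exp_has_derivative_at_0 by simp
  from has_derivative_mult_right[OF this, of "exp (f t)"]
  have "((\<lambda>s. exp (f t) * exp (f s - f t)) has_vector_derivative exp (f t) * f') (at t within S)"
    by (simp add: has_vector_derivative_def)
  moreover have "exp (f t) * exp (f s - f t) = exp (f s)" if "s \<in> S" for s
    using comm[OF that] by (subst exp_add_commuting[symmetric]) (simp_all add: algebra_simps)
  ultimately show ?thesis
    using \<open>t \<in> S\<close> by (auto elim: has_vector_derivative_transform[rotated 2])
qed

lemma exp_commute:
  fixes x y :: "'a::{real_normed_algebra_1,banach}"
  assumes "x * y = y * x"
  shows "exp x * y = y * exp x"
proof -
  have "x ^ n * y = y * x ^ n" for n
    using assms by (rule power_commuting_commutes)
  moreover have "(\<lambda>n. (x ^ n /\<^sub>R fact n) * y) sums (exp x * y)"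
    "(\<lambda>n. y * (x ^ n /\<^sub>R fact n)) sums (y * exp x)"
    by (intro sums_mult sums_mult2 exp_converges)+
  ultimately show ?thesis by (auto intro: sums_unique2)
qed

lemma mult_integral_commute:
  fixes f :: "'b::euclidean_space \<Rightarrow> 'a::{real_normed_algebra_1,banach}"
  assumes "f integrable_on S" "\<And>t. t \<in> S \<Longrightarrow> c * f t = f t * c"
  shows "c * integral S f = integral S f * c"
proof -
  have "c * integral S f = integral S (\<lambda>t. c * f t)"
    using integral_linear[OF assms(1) bounded_linear_mult_right[of c]] by (simp add: o_def)
  also have "\<dots> = integral S (\<lambda>t. f t * c)"
    by (rule integral_cong) (rule assms(2))
  also have "\<dots> = integral S f * c"
    using integral_linear[OF assms(1) bounded_linear_mult_left[of c]] by (simp add: o_def)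
  finally show ?thesis .
qed

text \<open>Here \<open>r t\<close> is the inverse of \<open>1 + t a\<close>. With
  \<open>l s\<close> the integral up to \<open>s\<close>, the product
  \<open>exp (- l s) * (1 + s a)\<close> has derivative zero and equals \<open>1\<close> at
  \<open>s = 0\<close>.\<close>

lemma exp_integral_resolvent:
  fixes a :: "'a::{real_normed_algebra_1,banach}"
  assumes cont: "continuous_on {0..1} r"
    and right: "\<And>t. t \<in> {0..1} \<Longrightarrow> (1 + t *\<^sub>R a) * r t = 1"
    and left: "\<And>t. t \<in> {0..1} \<Longrightarrow> r t * (1 + t *\<^sub>R a) = 1"
  shows "exp (integral {0..1} (\<lambda>t. a * r t)) = 1 + a"
proof -
  define l where "l s = integral {0..s} (\<lambda>t. a * r t)" for s
  \<comment> \<open>Insert \<open>r t * (1 + t a) = 1\<close> on the left and move \<open>c\<close>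
    across the bracket.\<close>
  have comm_r: "c * r t = r t * c" if "c * a = a * c" "t \<in> {0..1}" for c t
  proof -
    have "c * r t = r t * ((1 + t *\<^sub>R a) * c) * r t"
      using left that by (simp add: mult.assoc[symmetric])
    also have "(1 + t *\<^sub>R a) * c = c * (1 + t *\<^sub>R a)"
      using that(1) by (simp add: algebra_simps)
    also have "r t * (c * (1 + t *\<^sub>R a)) * r t = r t * c"
      using right that by (simp add: mult.assoc)
    finally show ?thesis by simp
  qed
  have comm_l: "c * l s = l s * c" if "c * a = a * c" "s \<in> {0..1}" for c s
    unfolding l_def
  proof (rule mult_integral_commute)
    show "(\<lambda>t. a * r t) integrable_on {0..s}"
      using that by (intro integrable_continuous_real continuous_intros continuous_on_subset[OF cont]) auto
    show "c * (a * r t) = a * r t * c" if t: "t \<in> {0..s}" for t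
    proof -
      have "c * (a * r t) = a * (c * r t)"
        using \<open>c * a = a * c\<close> by (simp add: mult.assoc[symmetric])
      also have "c * r t = r t * c"
        using t \<open>s \<in> _\<close> by (intro comm_r \<open>c * a = a * c\<close>) auto
      finally show ?thesis by (simp add: mult.assoc)
    qed
  qed
  have a_l: "a * l s = l s * a" if "s \<in> {0..1}" for s
    using comm_l that by simp
  \<comment> \<open>The commutation of \<open>l s\<close> with \<open>a\<close>, itself a case of
    \<open>comm_l\<close>, makes \<open>c = l s\<close> admissible in \<open>comm_l\<close>.\<close>
  have l_l: "l s * l t = l t * l s" if "s \<in> {0..1}" "t \<in> {0..1}" for s t
    using comm_l[of "l s" t] a_l that by simp
  have l_deriv: "(l has_vector_derivative a * r s) (at s within {0..1})" if "s \<in> {0..1}" for s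
    unfolding l_def using that
    by (intro integral_has_vector_derivative continuous_intros cont)
  have "((\<lambda>s. exp (- l s) * (1 + s *\<^sub>R a)) has_vector_derivative 0) (at s within {0..1})"
    if s: "s \<in> {0..1}" for s
  proof -
    have "((\<lambda>s. exp (- l s)) has_vector_derivative exp (- l s) * (- (a * r s))) (at s within {0..1})"
      using s l_l by (intro exp_has_vector_derivative_commuting has_vector_derivative_minus l_deriv) auto
    moreover have "((\<lambda>s. 1 + s *\<^sub>R a) has_vector_derivative a) (at s within {0..1})"
      by (auto intro!: derivative_eq_intros)
    ultimately have "((\<lambda>s. exp (- l s) * (1 + s *\<^sub>R a)) has_vector_derivative
        exp (- l s) * a + exp (- l s) * (- (a * r s)) * (1 + s *\<^sub>R a)) (at s within {0..1})"
      by (rule has_vector_derivative_mult)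
    moreover have "exp (- l s) * (- (a * r s)) * (1 + s *\<^sub>R a) = - (exp (- l s) * a)"
      using left[OF s] by (simp add: mult.assoc)
    ultimately show ?thesis by simp
  qed
  then obtain c where c: "\<And>s. s \<in> {0..1} \<Longrightarrow> exp (- l s) * (1 + s *\<^sub>R a) = c"
    by (rule has_vector_derivative_zero_constant[OF convex_real_interval(5)]) blast+
  have "exp (- l 1) * (1 + a) = 1"
    using c[of 0] c[of 1] by (simp add: l_def)
  then have "exp (l 1) * (exp (- l 1) * (1 + a)) = exp (l 1)" by simp
  then show ?thesis
    by (simp add: mult.assoc[symmetric] exp_minus_inverse l_def)
qed

section \<open>The matrix exponential and eigenvectors\<close>

lemma bounded_bilinear_matrix_matrix_mult:
  "bounded_bilinear ((**) :: complex ^ 'n ^ 'm \<Rightarrow> complex ^ 'p ^ 'n \<Rightarrow> complex ^ 'p ^ 'm)"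
proof -
  have "bilinear ((**) :: complex ^ 'n ^ 'm \<Rightarrow> complex ^ 'p ^ 'n \<Rightarrow> complex ^ 'p ^ 'm)"
    by (auto simp: bilinear_def matrix_matrix_mult_def vec_eq_iff algebra_simps sum.distrib scaleR_sum_right
        intro!: linearI)
  then show ?thesis by (simp add: bilinear_conv_bounded_bilinear)
qed

lemma bounded_bilinear_matrix_vector_mult:
  "bounded_bilinear ((*v) :: complex ^ 'n ^ 'm \<Rightarrow> complex ^ 'n \<Rightarrow> complex ^ 'm)"
proof -
  have "bilinear ((*v) :: complex ^ 'n ^ 'm \<Rightarrow> complex ^ 'n \<Rightarrow> complex ^ 'm)"
    by (auto simp: bilinear_def matrix_vector_mult_def vec_eq_iff algebra_simps sum.distrib scaleR_sum_right
        intro!: linearI)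
  then show ?thesis by (simp add: bilinear_conv_bounded_bilinear)
qed

interpretation matmul: bounded_bilinear
  "(**) :: complex ^ 'n ^ 'm \<Rightarrow> complex ^ 'p ^ 'n \<Rightarrow> complex ^ 'p ^ 'm"
  by (rule bounded_bilinear_matrix_matrix_mult)

interpretation matvec: bounded_bilinear
  "(*v) :: complex ^ 'n ^ 'm \<Rightarrow> complex ^ 'n \<Rightarrow> complex ^ 'm"
  by (rule bounded_bilinear_matrix_vector_mult)

lemma bounded_linear_trace: "bounded_linear (trace :: complex ^ 'n ^ 'n \<Rightarrow> complex)"
  by (auto simp: linear_conv_bounded_linear[symmetric] trace_def sum.distrib scaleR_sum_right
      intro!: linearI)

lemma bounded_linear_vector_scalar_mult: "bounded_linear (\<lambda>z. z *s (v :: complex ^ 'n))"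
  by (auto simp: linear_conv_bounded_linear[symmetric] vec_eq_iff algebra_simps intro!: linearI)

lemma matrix_vector_mult_axis_nth: "(A *v axis j 1) $ i = (A :: complex ^ 'n ^ 'm) $ i $ j"
  by (simp add: matrix_vector_mult_def axis_def if_distrib cong: if_cong)

text \<open>The injective algebra homomorphism along which facts about \<open>exp\<close> are pulled
  back to \<open>matrix_exp\<close>.\<close>

definition bop_of_matrix :: "complex ^ 'n ^ 'n \<Rightarrow> (complex ^ 'n) bop" where
  "bop_of_matrix A = Abs_bop (Blinfun ((*v) A))"

lemma bop_apply_bop_of_matrix [simp]: "bop_apply (bop_of_matrix A) v = A *v v"
  by (simp add: bop_of_matrix_def bop_apply.rep_eq Abs_bop_inverse bounded_linear_Blinfun_apply
      matvec.bounded_linear_right)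

lemma bounded_linear_bop_of_matrix: "bounded_linear bop_of_matrix"
  by (auto simp: linear_conv_bounded_linear[symmetric] matvec.add_left matvec.scaleR_left
      intro!: linearI bop_eqI)

lemma bop_of_matrix_simps:
  "bop_of_matrix (A + B) = bop_of_matrix A + bop_of_matrix B"
  "bop_of_matrix (A - B) = bop_of_matrix A - bop_of_matrix B"
  "bop_of_matrix (c *\<^sub>R A) = c *\<^sub>R bop_of_matrix A"
  "bop_of_matrix (A ** B) = bop_of_matrix A * bop_of_matrix B"
  "bop_of_matrix (mat 1) = 1"
  by (auto intro!: bop_eqI simp: matvec.add_left matvec.diff_left matvec.scaleR_left
      matrix_vector_mul_assoc)

lemma bop_of_matrix_inject: "bop_of_matrix A = bop_of_matrix B \<longleftrightarrow> A = B"
  by (metis bop_apply_bop_of_matrix matrix_eq)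

lemma bop_of_matrix_power: "bop_of_matrix (((**) A ^^ k) (mat 1)) = bop_of_matrix A ^ k"
  by (induction k) (simp_all add: bop_of_matrix_simps)

text \<open>\<open>matrix_exp\<close> is a \<open>suminf\<close>, so its series must first be shown
  to converge. Its terms map to those of the operator exponential, whose entries converge.\<close>

lemma bop_of_matrix_exp:
  fixes A :: "complex ^ 'n ^ 'n"
  shows "bop_of_matrix (matrix_exp A) = exp (bop_of_matrix A)"
proof -
  define S where "S k = (1 / fact k) *\<^sub>R (((**) A ^^ k) (mat 1))" for k
  \<comment> \<open>The matrix of the operator exponential in the standard basis, the candidate for
    the sum.\<close>
  define B :: "complex ^ 'n ^ 'n" where
    "B = (\<chi> i j. bop_apply (exp (bop_of_matrix A)) (axis j 1) $ i)"
  have S: "bop_of_matrix (S k) = bop_of_matrix A ^ k /\<^sub>R fact k" for k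
    by (simp add: S_def bop_of_matrix_simps bop_of_matrix_power inverse_eq_divide)
  have "(\<lambda>k. S k $ i $ j) sums (B $ i $ j)" for i j
  proof -
    have "bounded_linear (\<lambda>f. bop_apply f (axis j 1 :: complex ^ 'n) $ i)"
      using bounded_linear_compose[OF bounded_linear_vec_nth bounded_linear_bop_apply] .
    from bounded_linear.sums[OF this exp_converges[of "bop_of_matrix A"]]
    show ?thesis
      by (simp add: S[symmetric] B_def matrix_vector_mult_axis_nth)
  qed
  then have "S sums B"
    unfolding sums_def by (intro vec_tendstoI) simp
  then have "matrix_exp A = B"
    by (simp add: matrix_exp_def S_def[abs_def] sums_iff)
  moreover have "(\<lambda>k. bop_of_matrix (S k)) sums bop_of_matrix B"
    using \<open>S sums B\<close> by (rule bounded_linear.sums[OF bounded_linear_bop_of_matrix])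
  ultimately show ?thesis
    using exp_converges[of "bop_of_matrix A"] by (simp add: S sums_iff)
qed

lemma matrix_exp_commute:
  assumes "A ** B = B ** A"
  shows "matrix_exp A ** B = B ** matrix_exp A"
  using exp_commute[of "bop_of_matrix A" "bop_of_matrix B"] assms
  by (metis bop_of_matrix_exp bop_of_matrix_inject bop_of_matrix_simps(4))

lemma matrix_exp_diff_eq_mat_1:
  assumes "A ** B = B ** A" "matrix_exp A = matrix_exp B"
  shows "matrix_exp (A - B) = mat 1"
proof -
  let ?a = "bop_of_matrix A" and ?b = "bop_of_matrix B"
  have "?a * ?b = ?b * ?a"
    using assms(1) by (metis bop_of_matrix_simps(4))
  then have "exp (?a - ?b) = exp ?a * exp (- ?b)"
    by (subst exp_add_commuting[symmetric]) simp_all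
  also have "exp ?a = exp ?b"
    using assms(2) by (metis bop_of_matrix_exp)
  finally show ?thesis
    by (simp add: exp_minus_inverse bop_of_matrix_inject[symmetric] bop_of_matrix_exp bop_of_matrix_simps)
qed

lemma matrix_exp_apply_sums:
  "(\<lambda>k. (((*v) A ^^ k) v) /\<^sub>R fact k) sums (matrix_exp A *v v)"
proof -
  have "bop_apply (bop_of_matrix A ^ k) v = ((*v) A ^^ k) v" for k
    by (induction k) simp_all
  then show ?thesis
    using bounded_linear.sums[OF bounded_linear_bop_apply exp_converges[of "bop_of_matrix A"], of v]
    by (simp add: bop_of_matrix_exp[symmetric])
qed

lemma matrix_exp_apply_eigenvector:
  assumes "A *v v = z *s v"
  shows "matrix_exp A *v v = exp z *s v"
proof -
  have "((*v) A ^^ k) v = z ^ k *s v" for k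
    by (induction k) (simp_all add: vector_scalar_commute assms mult.commute)
  moreover have "(\<lambda>k. (z ^ k /\<^sub>R fact k) *s v) sums (exp z *s v)"
    by (rule bounded_linear.sums[OF bounded_linear_vector_scalar_mult exp_converges])
  moreover have "(c *\<^sub>R z) *s v = c *\<^sub>R (z *s v)" for c z
    by (simp add: vec_eq_iff)
  ultimately show ?thesis
    using matrix_exp_apply_sums[of A v] by (auto intro: sums_unique2)
qed

lemma matrix_exp_apply_square_zero:
  assumes "A *v (A *v v) = 0"
  shows "matrix_exp A *v v = v + A *v v"
proof -
  have "((*v) A ^^ Suc (Suc k)) v = 0" for k
    by (induction k) (simp_all add: assms)
  then have "((*v) A ^^ k) v = 0" if "k \<notin> {..<2}" for k
    using that by (metis One_nat_def Suc_1 lessThan_iff less_2_cases_iff not0_implies_Suc)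
  then have "(\<lambda>k. (((*v) A ^^ k) v) /\<^sub>R fact k) sums (\<Sum>k<2. (((*v) A ^^ k) v) /\<^sub>R fact k)"
    by (intro sums_finite) simp_all
  also have "(\<Sum>k<2. (((*v) A ^^ k) v) /\<^sub>R fact k) = v + A *v v"
    by (simp add: numeral_2_eq_2)
  finally show ?thesis
    using matrix_exp_apply_sums[of A v] by (auto intro: sums_unique2)
qed

section \<open>Annihilating polynomials and eigenvectors in invariant sets\<close>

definition poly_apply :: "complex ^ 'n ^ 'n \<Rightarrow> complex poly \<Rightarrow> complex ^ 'n \<Rightarrow> complex ^ 'n" where
  "poly_apply A p v = fold_coeffs (\<lambda>c w. c *s v + A *v w) p 0"

lemma poly_apply_0 [simp]: "poly_apply A 0 v = 0"
  by (simp add: poly_apply_def)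

text \<open>Horner's rule for the vector \<open>p(A) v\<close>. The case \<open>p = 0\<close>,
  \<open>c = 0\<close> is separate because \<open>pCons 0 0\<close> is \<open>0\<close> and the fold
  does not visit it.\<close>

lemma poly_apply_pCons [simp]: "poly_apply A (pCons c p) v = c *s v + A *v poly_apply A p v"
  by (cases "p = 0 \<and> c = 0") (auto simp: poly_apply_def)

lemma poly_apply_add: "poly_apply A (p + q) v = poly_apply A p v + poly_apply A q v"
  by (induction p q rule: poly_induct2)
    (simp_all add: matrix_vector_right_distrib vector_sadd_rdistrib)

text \<open>Moving a linear factor from the polynomial to the vector is what permits induction on
  the degree.\<close>

lemma poly_apply_mult_linear:
  "poly_apply A ([:-z, 1:] * q) v = poly_apply A q (A *v v - z *s v)"
proof (induction q)
  case (pCons c q)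
  have "[:-z, 1:] * pCons c q = [:-z * c, c:] + pCons 0 ([:-z, 1:] * q)"
    by simp
  then show ?case
    by (simp only: poly_apply_add poly_apply_pCons poly_apply_0 pCons.IH)
      (simp add: vec_eq_iff matrix_vector_right_distrib vector_scalar_commute algebra_simps)
qed simp

text \<open>In finite dimension the iterates of \<open>v\<close> under \<open>A\<close> either
  repeat or are infinitely many and hence dependent; both cases give a nonzero polynomial.\<close>

lemma annihilating_poly_exists: "\<exists>p. p \<noteq> 0 \<and> poly_apply A p v = 0"
proof -
  let ?u = "\<lambda>k. ((*v) A ^^ k) v"
  have monom: "poly_apply A (monom c k) v = c *s ?u k" for c k
    by (induction k) (simp_all add: monom_0 monom_Suc vector_scalar_commute)
  show ?thesis
  \<comment> \<open>Linear dependence concerns the set of iterates and says nothing about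
    repetitions, so these are treated first.\<close>
  proof (cases "inj ?u")
    case False
    then obtain i j where "i \<noteq> j" "?u i = ?u j" by (auto simp: inj_def)
    then have "monom 1 i + monom (-1) j \<noteq> (0 :: complex poly)" "poly_apply A (monom 1 i + monom (-1) j) v = 0"
      by (auto simp: poly_apply_add monom poly_eq_iff vector_smult_lneg intro!: exI[of _ i])
    then show ?thesis by blast
  next
    case True
    have "dependent (range ?u)"
      using True by (intro dependent_biggerset) (simp add: finite_image_iff)
    then obtain T f where T: "finite T" "T \<subseteq> range ?u" "(\<Sum>w\<in>T. f w *\<^sub>R w) = 0"
        and "\<exists>w\<in>T. f w \<noteq> (0 :: real)"
      by (auto simp: dependent_explicit)
    then obtain k0 where k0: "?u k0 \<in> T" "f (?u k0) \<noteq> 0" by blast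
    define I where "I = ?u -` T"
    have I: "finite I" "?u ` I = T"
      using T True by (auto simp: I_def intro: finite_vimageI)
    define p where "p = (\<Sum>k\<in>I. monom (of_real (f (?u k)) :: complex) k)"
    have "coeff p k0 = of_real (f (?u k0))"
      using I(1) k0(1) by (simp add: p_def coeff_sum I_def)
    moreover have "poly_apply A p v = (\<Sum>k\<in>I. complex_of_real (f (?u k)) *s ?u k)"
      unfolding p_def using I(1) by (induction I) (simp_all add: poly_apply_add monom)
    moreover have "\<dots> = (\<Sum>k\<in>I. f (?u k) *\<^sub>R ?u k)"
      by (simp add: vec_eq_iff scaleR_conv_of_real[where 'a = complex])
    moreover have "\<dots> = (\<Sum>w\<in>T. f w *\<^sub>R w)"
      unfolding I(2)[symmetric] using True by (subst sum.reindex) (auto intro: inj_on_subset)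
    ultimately show ?thesis
      using T(3) k0(2) by (intro exI[of _ p]) auto
  qed
qed

text \<open>Induction on the degree of an annihilating polynomial of \<open>v\<close>. With a root
  \<open>z\<close> it factors as \<open>(x - z) q\<close>; either \<open>v\<close> is an eigenvector
  for \<open>z\<close>, or \<open>A v - z v\<close> is a nonzero element of \<open>S\<close>
  annihilated by \<open>q\<close>.\<close>

lemma invariant_set_eigenvector:
  fixes A :: "complex ^ 'n ^ 'n"
  assumes closed: "\<And>w z. w \<in> S \<Longrightarrow> A *v w - z *s w \<in> S" and v: "v \<in> S" "v \<noteq> 0"
  obtains w z where "w \<in> S" "w \<noteq> 0" "A *v w = z *s w"
proof -
  obtain p where "p \<noteq> 0" "poly_apply A p v = 0"
    using annihilating_poly_exists by blast
  then have "\<exists>w\<in>S. \<exists>z. w \<noteq> 0 \<and> A *v w = z *s w"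
    using v
  proof (induction "degree p" arbitrary: p v rule: less_induct)
    case less
    show ?case
    proof (cases "degree p = 0")
      case True
      then obtain c where "p = [:c:]" by (meson degree_eq_zeroE)
      with less.prems show ?thesis by simp
    next
      case False
      then obtain z where "poly p z = 0"
        using fundamental_theorem_of_algebra[of p] by (auto simp: constant_degree)
      then obtain q where q: "p = [:-z, 1:] * q"
        by (metis dvdE poly_eq_0_iff_dvd)
      show ?thesis
      proof (cases "A *v v - z *s v = 0")
        case True
        then show ?thesis using less.prems by auto
      next
        case False
        have "q \<noteq> 0" using q less.prems(1) by auto
        then have "degree q < degree p"
          unfolding q by (subst degree_mult_eq) auto
        from less.hyps[OF this \<open>q \<noteq> 0\<close> _ closed[OF less.prems(3)] False] less.prems(2) show ?thesis
          by (simp only: q poly_apply_mult_linear)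
      qed
    qed
  qed
  with that show ?thesis by blast
qed

text \<open>The eigenspace of \<open>A\<close> for \<open>z\<close> is invariant under every
  \<open>B - b\<close>, so it contains an eigenvector of \<open>B\<close>.\<close>

lemma commuting_eigenvector:
  fixes A B :: "complex ^ 'n ^ 'n"
  assumes comm: "A ** B = B ** A" and "eigenvalue A z"
  obtains w b where "w \<noteq> 0" "A *v w = z *s w" "B *v w = b *s w"
proof -
  obtain v where v: "v \<noteq> 0" "A *v v = z *s v"
    using assms(2) by (auto simp: eigenvalue_def)
  have inv: "A *v (B *v w - b *s w) = z *s (B *v w - b *s w)" if "A *v w = z *s w" for w b
  proof -
    have "A *v (B *v w) = B *v (A *v w)"
      by (simp add: matrix_vector_mul_assoc comm)
    then show ?thesis
      using that by (simp add: matrix_vector_mult_diff_distrib vector_scalar_commute vector_ssub_ldistrib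
          vector_smult_assoc mult.commute)
  qed
  obtain w b where "A *v w = z *s w" "w \<noteq> 0" "B *v w = b *s w"
    by (rule invariant_set_eigenvector[of "{w. A *v w = z *s w}" B v]) (use inv v in auto)
  with that show ?thesis by blast
qed

text \<open>
  If \<open>A \<noteq> 0\<close>, its range contains an eigenvector \<open>w = A u\<close>; the eigenvalue being \<open>0\<close>, the exponential
  series stops after two terms and \<open>u = exp(A) u = u + w\<close>.
\<close>

lemma matrix_exp_eq_mat_1_imp_eq_0:
  assumes "matrix_exp A = mat 1" and zero: "\<And>z. eigenvalue A z \<Longrightarrow> z = 0"
  shows "A = 0"
proof (rule ccontr)
  assume "A \<noteq> 0"
  then obtain v where "A *v v \<noteq> 0"
    by (metis matrix_eq matvec.zero_left)
  then obtain w z where w: "w \<in> range ((*v) A)" "w \<noteq> 0" "A *v w = z *s w"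
  proof (rule invariant_set_eigenvector[rotated 2])
    show "A *v w - z *s w \<in> range ((*v) A)" if "w \<in> range ((*v) A)" for w z
    proof -
      obtain u where "w = A *v u" using \<open>w \<in> _\<close> by blast
      then have "A *v w - z *s w = A *v (w - z *s u)"
        by (simp add: matrix_vector_mult_diff_distrib vector_scalar_commute)
      then show ?thesis by blast
    qed
  qed auto
  then have "z = 0" using zero by (auto simp: eigenvalue_def)
  obtain u where "w = A *v u" using w(1) by blast
  with w(3) \<open>z = 0\<close> have "matrix_exp A *v u = u + w"
    by (simp add: matrix_exp_apply_square_zero)
  with assms(1) w(2) show False by simp
qed

text \<open>On a common eigenvector of \<open>L - M\<close> and \<open>M\<close>, with eigenvalues
  \<open>z\<close> and \<open>m\<close>, \<open>L\<close> has eigenvalue \<open>m + z\<close>. Then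
  \<open>exp (m + z) = exp m\<close>, and the strip has width \<open>2 * pi\<close>, so
  \<open>z = 0\<close>.\<close>

lemma matrix_exp_inj_strip:
  assumes comm: "L ** M = M ** L" and eq: "matrix_exp L = matrix_exp M"
    and L: "\<And>z. eigenvalue L z \<Longrightarrow> - pi < Im z \<and> Im z < pi"
    and M: "\<And>z. eigenvalue M z \<Longrightarrow> - pi < Im z \<and> Im z < pi"
  shows "L = M"
proof -
  have "z = 0" if z: "eigenvalue (L - M) z" for z
  proof -
    have "(L - M) ** M = M ** (L - M)"
      by (simp add: matmul.diff_left matmul.diff_right comm)
    then obtain w m where w: "w \<noteq> 0" "(L - M) *v w = z *s w" "M *v w = m *s w"
      using commuting_eigenvector[OF _ z] by blast
    have Lw: "L *v w = (m + z) *s w"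
      using w by (simp add: matvec.diff_left vector_sadd_rdistrib algebra_simps)
    have "exp (m + z) *s w = exp m *s w"
      using matrix_exp_apply_eigenvector[OF Lw] matrix_exp_apply_eigenvector[OF w(3)] eq by metis
    then have "exp (m + z) = exp m"
      using w(1) by simp
    moreover have "eigenvalue L (m + z)" "eigenvalue M m"
      using Lw w(1,3) by (auto simp: eigenvalue_def)
    then have "\<bar>Im (m + z) - Im m\<bar> < 2 * pi"
      using L[of "m + z"] M[of m] by linarith
    ultimately have "m + z = m" by (rule exp_complex_eqI[rotated])
    then show ?thesis by simp
  qed
  with matrix_exp_eq_mat_1_imp_eq_0[OF matrix_exp_diff_eq_mat_1[OF comm eq]] show ?thesis
    by simp
qed

section \<open>The principal logarithm as an integral of resolvents\<close>

lemma invertible_iff_ker: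
  fixes A :: "complex ^ 'n ^ 'n"
  shows "invertible A \<longleftrightarrow> (\<forall>v. A *v v = 0 \<longrightarrow> v = 0)"
  by (simp add: invertible_left_inverse matrix_left_invertible_ker)

lemma
  fixes A :: "complex ^ 'n ^ 'n"
  assumes "invertible A"
  shows matrix_inv_right: "A ** matrix_inv A = mat 1"
    and matrix_inv_left: "matrix_inv A ** A = mat 1"
proof -
  have "A ** matrix_inv A = mat 1 \<and> matrix_inv A ** A = mat 1"
    using assms unfolding invertible_def matrix_inv_def by (rule someI_ex)
  then show "A ** matrix_inv A = mat 1" "matrix_inv A ** A = mat 1" by auto
qed

text \<open>Cramer's rule, column by column. It makes the inverse a rational function of the
  entries, whence both its continuity and its reality for real matrices.\<close>

lemma matrix_inv_eq_det:
  fixes A :: "complex ^ 'n ^ 'n"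
  assumes "invertible A"
  shows "matrix_inv A = (\<chi> k j. det (\<chi> r c. if c = k then axis j 1 $ r else A $ r $ c) / det A)"
proof -
  have "A *v (matrix_inv A *v axis j 1) = axis j 1" for j
    using assms by (simp add: matrix_vector_mul_assoc matrix_inv_right)
  then have "matrix_inv A *v axis j 1 =
      (\<chi> k. det (\<chi> r c. if c = k then axis j 1 $ r else A $ r $ c) / det A)" for j
    using cramer[of A] assms by (simp add: invertible_det_nz)
  then have "(matrix_inv A *v axis j 1) $ k =
      det (\<chi> r c. if c = k then axis j 1 $ r else A $ r $ c) / det A" for j k
    by simp
  then show ?thesis
    by (simp add: vec_eq_iff matrix_vector_mult_axis_nth)
qed

lemma continuous_on_det:
  fixes f :: "'a::topological_space \<Rightarrow> complex ^ 'n ^ 'n"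
  shows "continuous_on S f \<Longrightarrow> continuous_on S (\<lambda>x. det (f x))"
  unfolding det_def by (intro continuous_intros)

lemma continuous_on_matrix_inv:
  fixes f :: "'a::topological_space \<Rightarrow> complex ^ 'n ^ 'n"
  assumes f: "continuous_on S f" and inv: "\<And>x. x \<in> S \<Longrightarrow> invertible (f x)"
  shows "continuous_on S (\<lambda>x. matrix_inv (f x))"
proof -
  have "continuous_on S (\<lambda>x. if c = k then axis j 1 $ r else f x $ r $ c)" for c k j r
    by (cases "c = k") (auto intro!: continuous_intros f)
  then have "continuous_on S
      (\<lambda>x. \<chi> k j. det (\<chi> r c. if c = k then axis j 1 $ r else f x $ r $ c) / det (f x))"
    using inv by (intro continuous_on_vec_lambda continuous_on_divide continuous_on_det f)
      (auto simp: invertible_det_nz)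
  then show ?thesis
    using inv by (simp add: matrix_inv_eq_det cong: continuous_on_cong)
qed

lemma det_in_Reals: "A \<in> mats_over \<real> \<Longrightarrow> det A \<in> \<real>"
  unfolding det_def mats_over_def by (intro sum_in_Reals Reals_mult prod_in_Reals) auto

lemma matrix_inv_in_mats_over_Reals:
  assumes "A \<in> mats_over \<real>" "invertible A"
  shows "matrix_inv A \<in> mats_over \<real>"
proof -
  have "(\<chi> r c. if c = k then axis j 1 $ r else A $ r $ c) \<in> mats_over \<real>" for k j
    using assms(1) by (simp add: mats_over_def axis_def)
  then show ?thesis
    using assms by (auto simp: matrix_inv_eq_det mats_over_def[of \<real>] intro!: Reals_divide det_in_Reals)
qed

text \<open>Caratheodory's criterion: \<open>h\<close> is the difference quotient at
  \<open>x\<close>, extended continuously to \<open>x\<close>.\<close>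

lemma has_vector_derivative_slopeI:
  fixes f :: "real \<Rightarrow> 'a::real_normed_vector"
  assumes slope: "\<And>y. y \<in> S \<Longrightarrow> f y - f x = (y - x) *\<^sub>R h y" and h: "continuous_on S h" "x \<in> S"
  shows "(f has_vector_derivative h x) (at x within S)"
  unfolding has_vector_derivative_def
proof (rule has_derivativeI_sandwich[where e = 1 and H = "\<lambda>y. norm (h y - h x)"])
  show "bounded_linear (\<lambda>t. t *\<^sub>R h x)" by (rule bounded_linear_scaleR_left)
  show "norm (f y - f x - (y - x) *\<^sub>R h x) / norm (y - x) \<le> norm (h y - h x)" if "y \<in> S" "y \<noteq> x" for y
    using that by (simp add: slope scaleR_diff_right[symmetric])
  have "(h \<longlongrightarrow> h x) (at x within S)"
    using h by (auto simp: continuous_on_def)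
  then show "((\<lambda>y. norm (h y - h x)) \<longlongrightarrow> 0) (at x within S)"
    by (auto intro!: tendsto_eq_intros)
qed simp

text \<open>The resolvent identity \<open>R y - R x = (x - y) R y C R x\<close> exhibits a
  continuous slope function.\<close>

lemma matrix_inv_has_vector_derivative:
  fixes B C :: "complex ^ 'n ^ 'n"
  defines "R \<equiv> \<lambda>y :: real. matrix_inv (B + y *\<^sub>R C)"
  assumes inv: "\<And>y. y \<in> S \<Longrightarrow> invertible (B + y *\<^sub>R C)" and x: "x \<in> S"
  shows "(R has_vector_derivative - (R x ** C ** R x)) (at x within S)"
proof (rule has_vector_derivative_slopeI[where h = "\<lambda>y. - (R y ** C ** R x)"])
  have cont: "continuous_on S R"
    unfolding R_def using inv by (intro continuous_on_matrix_inv continuous_intros)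
  then show "continuous_on S (\<lambda>y. - (R y ** C ** R x))"
    by (intro continuous_intros matmul.continuous_on)
  show "R y - R x = (y - x) *\<^sub>R - (R y ** C ** R x)" if "y \<in> S" for y
  proof -
    have "R y - R x = R y ** ((B + x *\<^sub>R C) ** R x) - R y ** (B + y *\<^sub>R C) ** R x"
      unfolding R_def using inv that x by (simp add: matrix_inv_right matrix_inv_left)
    also have "\<dots> = (x - y) *\<^sub>R (R y ** C ** R x)"
      by (simp add: matrix_mul_assoc matmul.add_left matmul.add_right matmul.scaleR_left
          matmul.scaleR_right scaleR_diff_left)
    finally show ?thesis by (simp add: scaleR_diff_left)
  qed
qed (rule x)

section \<open>The segment from the identity to a matrix\<close>

definition slit_spectrum :: "complex ^ 'n ^ 'n \<Rightarrow> bool" where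
  "slit_spectrum A \<longleftrightarrow> (\<forall>z. eigenvalue A z \<longrightarrow> z \<notin> \<real>\<^sub>\<le>\<^sub>0)"

definition mat_segment :: "complex ^ 'n ^ 'n \<Rightarrow> real \<Rightarrow> complex ^ 'n ^ 'n" where
  "mat_segment A t = mat 1 + t *\<^sub>R (A - mat 1)"

lemma mat_segment_apply: "mat_segment A t *v v = (1 - t) *\<^sub>R v + t *\<^sub>R (A *v v)"
  by (simp add: mat_segment_def matvec.add_left matvec.scaleR_left matvec.diff_left algebra_simps)

lemma scaleR_eq_vector_scalar_mult: "c *\<^sub>R (v :: complex ^ 'n) = complex_of_real c *s v"
  by (simp add: vec_eq_iff scaleR_conv_of_real[where 'a = complex])

text \<open>For \<open>t > 0\<close>, singularity at \<open>t\<close> means that \<open>- (1 - t) / t\<close> is an eigenvalue of \<open>A\<close>.\<close>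

lemma slit_spectrum_iff_invertible_segment:
  "slit_spectrum A \<longleftrightarrow> (\<forall>t\<in>{0..1}. invertible (mat_segment A t))"
proof (intro iffI ballI)
  fix t :: real assume slit: "slit_spectrum A" and t: "t \<in> {0..1}"
  have "v = 0" if v: "mat_segment A t *v v = 0" for v
  proof (rule ccontr)
    assume "v \<noteq> 0"
    then have "t \<noteq> 0" using v by (auto simp: mat_segment_apply)
    have "t *\<^sub>R (A *v v) = - (1 - t) *\<^sub>R v"
      using v by (simp add: mat_segment_apply eq_neg_iff_add_eq_0 add.commute algebra_simps)
    then have "(1 / t) *\<^sub>R (t *\<^sub>R (A *v v)) = (1 / t) *\<^sub>R (- (1 - t) *\<^sub>R v)"
      by simp
    then have "A *v v = (- (1 - t) / t) *\<^sub>R v"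
      using \<open>t \<noteq> 0\<close> by simp
    then have "eigenvalue A (complex_of_real (- (1 - t) / t))"
      using \<open>v \<noteq> 0\<close> unfolding eigenvalue_def scaleR_eq_vector_scalar_mult by blast
    moreover have "complex_of_real (- (1 - t) / t) \<in> \<real>\<^sub>\<le>\<^sub>0"
      unfolding nonpos_Reals_of_real_iff using t by (auto intro!: divide_nonpos_nonneg)
    ultimately show False using slit by (auto simp: slit_spectrum_def)
  qed
  then show "invertible (mat_segment A t)" by (simp add: invertible_iff_ker)
next
  assume inv: "\<forall>t\<in>{0..1}. invertible (mat_segment A t)"
  have False if z: "eigenvalue A z" "z \<in> \<real>\<^sub>\<le>\<^sub>0" for z
  proof -
    obtain r where r: "z = complex_of_real r" "r \<le> 0"
      using z(2) by (auto elim: nonpos_Reals_cases)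
    obtain v where v: "v \<noteq> 0" "A *v v = r *\<^sub>R v"
      using z(1) r by (auto simp: eigenvalue_def scaleR_eq_vector_scalar_mult)
    \<comment> \<open>The solution of \<open>1 - t + t * r = 0\<close>; it lies in
      \<open>{0..1}\<close> because \<open>r \<le> 0\<close>.\<close>
    define t where "t = 1 / (1 - r)"
    have "mat_segment A t *v v = (1 - t + t * r) *\<^sub>R v"
      by (simp add: mat_segment_apply v(2) scaleR_add_left)
    also have "1 - t + t * r = 0"
      using r(2) by (simp add: t_def field_simps)
    finally have "\<not> invertible (mat_segment A t)"
      using v(1) by (auto simp: invertible_iff_ker)
    moreover have "t \<in> {0..1}" using r(2) by (simp add: t_def)
    ultimately show False using inv by blast
  qed
  then show "slit_spectrum A" by (auto simp: slit_spectrum_def)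
qed

lemmas invertible_mat_segment = slit_spectrum_iff_invertible_segment[THEN iffD1, rule_format]

definition log_integral :: "complex ^ 'n ^ 'n \<Rightarrow> complex ^ 'n ^ 'n" where
  "log_integral A = integral {0..1} (\<lambda>t. (A - mat 1) ** matrix_inv (mat_segment A t))"

lemma continuous_on_inv_segment:
  assumes "slit_spectrum A"
  shows "continuous_on {0..1} (\<lambda>t. matrix_inv (mat_segment A t))"
  using assms by (intro continuous_on_matrix_inv invertible_mat_segment)
    (auto simp: mat_segment_def intro!: continuous_intros)

lemma log_integrand_integrable:
  assumes "slit_spectrum A"
  shows "(\<lambda>t. (A - mat 1) ** matrix_inv (mat_segment A t)) integrable_on {0..1}"
  by (intro integrable_continuous_real matmul.continuous_on continuous_intros
      continuous_on_inv_segment assms)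

text \<open>Multiplications, evaluation at a vector and imaginary parts of entries are all moved
  under the integral in this way.\<close>

lemma bounded_linear_log_integral:
  assumes "slit_spectrum A" "bounded_linear h"
  shows "h (log_integral A) = integral {0..1} (\<lambda>t. h ((A - mat 1) ** matrix_inv (mat_segment A t)))"
  using integral_linear[OF log_integrand_integrable[OF assms(1)] assms(2)]
  by (simp add: log_integral_def o_def)

lemma matrix_inv_commute:
  fixes A C :: "complex ^ 'n ^ 'n"
  assumes "invertible A" "C ** A = A ** C"
  shows "C ** matrix_inv A = matrix_inv A ** C"
proof -
  have "C ** matrix_inv A = matrix_inv A ** (A ** C) ** matrix_inv A"
    using assms(1) by (simp add: matrix_mul_assoc matrix_inv_left)
  also have "\<dots> = matrix_inv A ** C ** (A ** matrix_inv A)"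
    by (simp add: assms(2)[symmetric] matrix_mul_assoc)
  finally show ?thesis using assms(1) by (simp add: matrix_inv_right)
qed

lemma inv_segment_commute:
  assumes "slit_spectrum A" "t \<in> {0..1}" "C ** A = A ** C"
  shows "C ** matrix_inv (mat_segment A t) = matrix_inv (mat_segment A t) ** C"
  using assms(3)
  by (intro matrix_inv_commute invertible_mat_segment assms(1,2))
    (simp add: mat_segment_def matmul.add_left matmul.add_right matmul.diff_left matmul.diff_right
      matmul.scaleR_left matmul.scaleR_right)

lemma log_integral_commute:
  assumes "slit_spectrum A" "C ** A = A ** C"
  shows "C ** log_integral A = log_integral A ** C"
proof -
  have "C ** log_integral A = integral {0..1} (\<lambda>t. C ** ((A - mat 1) ** matrix_inv (mat_segment A t)))"
    by (rule bounded_linear_log_integral[OF assms(1) matmul.bounded_linear_right])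
  also have "\<dots> = integral {0..1} (\<lambda>t. (A - mat 1) ** matrix_inv (mat_segment A t) ** C)"
  proof (rule integral_cong)
    fix t :: real assume t: "t \<in> {0..1}"
    have "C ** (A - mat 1) = (A - mat 1) ** C"
      using assms(2) by (simp add: matmul.diff_left matmul.diff_right)
    then show "C ** ((A - mat 1) ** matrix_inv (mat_segment A t))
        = (A - mat 1) ** matrix_inv (mat_segment A t) ** C"
      using inv_segment_commute[OF assms(1) t assms(2)] by (metis matrix_mul_assoc)
  qed
  also have "\<dots> = log_integral A ** C"
    by (rule bounded_linear_log_integral[OF assms(1) matmul.bounded_linear_left, symmetric])
  finally show ?thesis .
qed

lemma matrix_exp_log_integral:
  assumes "slit_spectrum A"
  shows "matrix_exp (log_integral A) = A"
proof -
  let ?R = "\<lambda>t. bop_of_matrix (matrix_inv (mat_segment A t))" and ?a = "bop_of_matrix (A - mat 1)"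
  have seg: "1 + t *\<^sub>R ?a = bop_of_matrix (mat_segment A t)" for t
    by (simp add: mat_segment_def bop_of_matrix_simps)
  have "exp (integral {0..1} (\<lambda>t. ?a * ?R t)) = 1 + ?a"
  proof (rule exp_integral_resolvent)
    show "continuous_on {0..1} ?R"
      by (intro bounded_linear.continuous_on[OF bounded_linear_bop_of_matrix] continuous_on_inv_segment assms)
    fix t :: real assume "t \<in> {0..1}"
    then show "(1 + t *\<^sub>R ?a) * ?R t = 1" "?R t * (1 + t *\<^sub>R ?a) = 1"
      unfolding seg using invertible_mat_segment[OF assms]
      by (simp_all add: bop_of_matrix_simps(4)[symmetric] matrix_inv_left matrix_inv_right bop_of_matrix_simps(5))
  qed
  also have "integral {0..1} (\<lambda>t. ?a * ?R t) = bop_of_matrix (log_integral A)"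
    using bounded_linear_log_integral[OF assms bounded_linear_bop_of_matrix] by (simp add: bop_of_matrix_simps(4))
  finally have "bop_of_matrix (matrix_exp (log_integral A)) = bop_of_matrix A"
    by (simp add: bop_of_matrix_exp bop_of_matrix_simps)
  then show ?thesis by (simp add: bop_of_matrix_inject)
qed

text \<open>The integrand is the derivative of \<open>Ln (1 + t * (a - 1))\<close>, taken along the
  segment from \<open>1\<close> to \<open>a\<close>.\<close>

lemma Ln_has_integral:
  assumes "a \<notin> \<real>\<^sub>\<le>\<^sub>0"
  shows "((\<lambda>t. (a - 1) / (1 + complex_of_real t * (a - 1))) has_integral Ln a) {0..1}"
proof -
  \<comment> \<open>The slit plane is star-shaped about \<open>1\<close>.\<close>
  have slit: "1 + complex_of_real t * (a - 1) \<notin> \<real>\<^sub>\<le>\<^sub>0" if "t \<in> {0..1}" for t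
  proof
    assume *: "1 + complex_of_real t * (a - 1) \<in> \<real>\<^sub>\<le>\<^sub>0"
    then have "t \<noteq> 0" by auto
    with * have "Im a = 0" "1 + t * (Re a - 1) \<le> 0"
      by (auto simp: complex_nonpos_Reals_iff)
    with assms have "Re a > 0" by (auto simp: complex_nonpos_Reals_iff)
    with that \<open>t \<noteq> 0\<close> have "1 - t + t * Re a > 0"
      by (intro add_nonneg_pos) auto
    with \<open>1 + t * (Re a - 1) \<le> 0\<close> show False by (simp add: algebra_simps)
  qed
  have "((\<lambda>t. (a - 1) / (1 + complex_of_real t * (a - 1))) has_integral
      Ln (1 + complex_of_real 1 * (a - 1)) - Ln (1 + complex_of_real 0 * (a - 1))) {0..1}"
    using slit
    by (intro fundamental_theorem_of_calculus
        has_vector_derivative_real_field[where f = "\<lambda>z. Ln (1 + z * (a - 1))"])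
      (auto intro!: derivative_eq_intros simp: field_simps)
  then show ?thesis by simp
qed

text \<open>On \<open>v\<close> the integrand acts as the scalar
  \<open>(a - 1) / (1 + t (a - 1))\<close>, which reduces the claim to the integral for
  \<open>Ln a\<close>.\<close>

lemma log_integral_apply_eigenvector:
  assumes slit: "slit_spectrum A" and v: "v \<noteq> 0" "A *v v = a *s v"
  shows "log_integral A *v v = Ln a *s v"
proof -
  have a: "a \<notin> \<real>\<^sub>\<le>\<^sub>0"
    using slit v by (auto simp: slit_spectrum_def eigenvalue_def)
  have "log_integral A *v v
      = integral {0..1} (\<lambda>t. ((A - mat 1) ** matrix_inv (mat_segment A t)) *v v)"
    by (rule bounded_linear_log_integral[OF slit matvec.bounded_linear_left])
  also have "\<dots> = integral {0..1} (\<lambda>t. ((a - 1) / (1 + complex_of_real t * (a - 1))) *s v)"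
  proof (rule integral_cong)
    fix t :: real assume "t \<in> {0..1}"
    then have inv: "invertible (mat_segment A t)" by (rule invertible_mat_segment[OF slit])
    define c where "c = 1 + complex_of_real t * (a - 1)"
    have seg: "mat_segment A t *v v = c *s v"
      unfolding mat_segment_apply scaleR_eq_vector_scalar_mult
      by (simp add: v(2) c_def vec_eq_iff algebra_simps)
    then have "c \<noteq> 0" using inv v(1) by (auto simp: invertible_iff_ker)
    have "c *s (matrix_inv (mat_segment A t) *v v) = v"
      using inv by (simp add: vector_scalar_commute[symmetric] seg[symmetric] matrix_vector_mul_assoc matrix_inv_left)
    then have "(1 / c) *s (c *s (matrix_inv (mat_segment A t) *v v)) = (1 / c) *s v" by simp
    then have "matrix_inv (mat_segment A t) *v v = (1 / c) *s v"
      using \<open>c \<noteq> 0\<close> by (simp add: vector_smult_assoc)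
    then have "((A - mat 1) ** matrix_inv (mat_segment A t)) *v v = (A - mat 1) *v ((1 / c) *s v)"
      by (simp add: matrix_vector_mul_assoc[symmetric])
    also have "\<dots> = ((a - 1) / c) *s v"
      by (simp add: vector_scalar_commute matvec.diff_left v(2) vec_eq_iff divide_simps algebra_simps)
    finally show "((A - mat 1) ** matrix_inv (mat_segment A t)) *v v
        = ((a - 1) / (1 + complex_of_real t * (a - 1))) *s v"
      by (simp add: c_def)
  qed
  also have "\<dots> = Ln a *s v"
    using has_integral_linear[OF Ln_has_integral[OF a] bounded_linear_vector_scalar_mult, of v]
    by (simp add: o_def integral_unique)
  finally show ?thesis .
qed

lemma matrix_Log_eq_log_integral:
  assumes slit: "slit_spectrum A"
  shows "matrix_Log A = log_integral A"
  unfolding matrix_Log_def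
proof (rule the_equality)
  \<comment> \<open>An eigenvector shared with \<open>A\<close> identifies \<open>z\<close> as
    \<open>Ln a\<close> for an eigenvalue \<open>a\<close> of \<open>A\<close>.\<close>
  have strip: "- pi < Im z \<and> Im z < pi" if z: "eigenvalue (log_integral A) z" for z
  proof -
    obtain w a where w: "w \<noteq> 0" "log_integral A *v w = z *s w" "A *v w = a *s w"
      using commuting_eigenvector[OF log_integral_commute[OF slit refl, symmetric] z] .
    have a: "a \<notin> \<real>\<^sub>\<le>\<^sub>0"
      using slit w by (auto simp: slit_spectrum_def eigenvalue_def)
    have "z *s w = Ln a *s w"
      using log_integral_apply_eigenvector[OF slit w(1,3)] w(2) by simp
    then have "z = Ln a" using w(1) by simp
    with a show ?thesis by (auto intro!: mpi_less_Im_Ln Im_Ln_less_pi)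
  qed
  then show "matrix_exp (log_integral A) = A \<and> (\<forall>z. eigenvalue (log_integral A) z \<longrightarrow> - pi < Im z \<and> Im z < pi)"
    using matrix_exp_log_integral[OF slit] by simp
  fix M assume M: "matrix_exp M = A \<and> (\<forall>z. eigenvalue M z \<longrightarrow> - pi < Im z \<and> Im z < pi)"
  \<comment> \<open>\<open>A\<close> is the exponential of \<open>M\<close>, hence commutes with
    \<open>M\<close>; commutation then passes to the integral.\<close>
  then have "M ** A = A ** M"
    using matrix_exp_commute[of M M] by simp
  then have "M ** log_integral A = log_integral A ** M"
    by (rule log_integral_commute[OF slit])
  then show "M = log_integral A"
    by (rule matrix_exp_inj_strip) (use M strip matrix_exp_log_integral[OF slit] in auto)
qed

text \<open>For \<open>K = \<real>\<close> this places the gradient among the real matrices.\<close>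

lemma log_integral_in_mats_over_Reals:
  assumes "A \<in> mats_over \<real>" "slit_spectrum A"
  shows "log_integral A \<in> mats_over \<real>"
proof -
  have entry: "((A - mat 1) ** matrix_inv (mat_segment A t)) $ i $ j \<in> \<real>" if t: "t \<in> {0..1}" for t i j
  proof -
    have "A - mat 1 \<in> mats_over \<real>" "mat_segment A t \<in> mats_over \<real>"
      using assms(1) by (auto simp: mats_over_def mat_def mat_segment_def scaleR_conv_of_real[where 'a = complex])
    moreover from this(2) have "matrix_inv (mat_segment A t) \<in> mats_over \<real>"
      using t assms(2) by (intro matrix_inv_in_mats_over_Reals invertible_mat_segment)
    ultimately show ?thesis
      by (auto simp: mats_over_def matrix_matrix_mult_def intro!: sum_in_Reals Reals_mult)
  qed
  have "Im (log_integral A $ i $ j) = 0" for i j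
  proof -
    have "bounded_linear (\<lambda>M :: complex ^ 'a ^ 'a. Im (M $ i $ j))"
      by (intro bounded_linear_compose[OF bounded_linear_Im] bounded_linear_compose[OF bounded_linear_vec_nth]
          bounded_linear_vec_nth)
    from bounded_linear_log_integral[OF assms(2) this]
    have "Im (log_integral A $ i $ j)
        = integral {0..1} (\<lambda>t. Im (((A - mat 1) ** matrix_inv (mat_segment A t)) $ i $ j))" .
    also have "\<dots> = integral {0..1} (\<lambda>t :: real. 0)"
      using entry by (intro integral_cong) (simp add: complex_is_Real_iff)
    finally show ?thesis by simp
  qed
  then show ?thesis by (simp add: mats_over_def complex_is_Real_iff)
qed

section \<open>The gradient of the von Neumann function\<close>

text \<open>The integrand is the derivative of \<open>trace (A (A - 1) R)\<close> in direction
  \<open>V\<close>. Its first term yields \<open>log_integral A\<close>; the other two amount to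
  \<open>trace (V (d/dt) (t A R t))\<close>, which integrates to \<open>trace V\<close>.\<close>

lemma trace_mult_log_integrand_integral:
  assumes slit: "slit_spectrum A"
  defines "R \<equiv> \<lambda>t. matrix_inv (mat_segment A t)"
  shows "integral {0..1} (\<lambda>t. trace (V ** ((A - mat 1) ** R t) + A ** (V ** R t)
      - A ** ((A - mat 1) ** (R t ** (t *\<^sub>R V) ** R t)))) = trace (V ** (log_integral A + mat 1))"
proof -
  \<comment> \<open>The function \<open>t A R t\<close> runs from \<open>0\<close> at
    \<open>t = 0\<close> to \<open>mat 1\<close> at \<open>t = 1\<close>, where the segment ends in
    \<open>A\<close>.\<close>
  have "((\<lambda>t. A ** R t - t *\<^sub>R (A ** (R t ** (A - mat 1) ** R t))) has_integral
      1 *\<^sub>R (A ** R 1) - 0 *\<^sub>R (A ** R 0)) {0..1}"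
  proof (rule fundamental_theorem_of_calculus)
    fix t :: real assume t: "t \<in> {0..1}"
    have "(R has_vector_derivative - (R t ** (A - mat 1) ** R t)) (at t within {0..1})"
      unfolding R_def mat_segment_def using t invertible_mat_segment[OF slit]
      by (intro matrix_inv_has_vector_derivative) (auto simp: mat_segment_def)
    from bounded_linear.has_vector_derivative[OF matmul.bounded_linear_right this, of A]
    show "((\<lambda>t. t *\<^sub>R (A ** R t)) has_vector_derivative
        A ** R t - t *\<^sub>R (A ** (R t ** (A - mat 1) ** R t))) (at t within {0..1})"
      by (auto intro!: derivative_eq_intros simp: matmul.minus_right)
  qed simp
  moreover have "A ** R 1 = mat 1"
    using invertible_mat_segment[OF slit, of 1] by (simp add: R_def mat_segment_def matrix_inv_right)
  ultimately have one: "((\<lambda>t. A ** R t - t *\<^sub>R (A ** (R t ** (A - mat 1) ** R t))) has_integral mat 1) {0..1}"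
    by simp
  have "((\<lambda>t. (A - mat 1) ** R t) has_integral log_integral A) {0..1}"
    unfolding log_integral_def R_def by (rule integrable_integral[OF log_integrand_integrable[OF slit]])
  from has_integral_linear[OF has_integral_add[OF this one]
      bounded_linear_compose[OF bounded_linear_trace matmul.bounded_linear_right[of V]]]
  have "((\<lambda>t. trace (V ** ((A - mat 1) ** R t + (A ** R t - t *\<^sub>R (A ** (R t ** (A - mat 1) ** R t))))))
      has_integral trace (V ** (log_integral A + mat 1))) {0..1}"
    by (simp add: o_def)
  then have int: "integral {0..1} (\<lambda>t. trace (V ** ((A - mat 1) ** R t
      + (A ** R t - t *\<^sub>R (A ** (R t ** (A - mat 1) ** R t)))))) = trace (V ** (log_integral A + mat 1))"
    by (rule integral_unique)
  \<comment> \<open>Cyclicity of the trace and commutation of \<open>R t\<close> with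
    \<open>A\<close> bring \<open>V\<close> to the front of every term.\<close>
  have eq: "trace (V ** ((A - mat 1) ** R t) + A ** (V ** R t)
        - A ** ((A - mat 1) ** (R t ** (t *\<^sub>R V) ** R t)))
      = trace (V ** ((A - mat 1) ** R t + (A ** R t - t *\<^sub>R (A ** (R t ** (A - mat 1) ** R t)))))"
    if t: "t \<in> {0..1}" for t
  proof -
    have R_A: "A ** R t = R t ** A"
      unfolding R_def by (rule inv_segment_commute[OF slit t refl])
    have R_A1: "(A - mat 1) ** R t = R t ** (A - mat 1)"
      by (simp add: matmul.diff_left matmul.diff_right R_A)
    have "trace (A ** (V ** R t)) = trace (V ** (R t ** A))"
      by (subst trace_mul_sym) (simp add: matrix_mul_assoc)
    moreover have "trace (A ** ((A - mat 1) ** (R t ** V ** R t))) = trace (V ** (A ** (R t ** (A - mat 1) ** R t)))"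
    proof -
      have "trace (A ** ((A - mat 1) ** (R t ** V ** R t))) = trace ((A ** (A - mat 1) ** R t) ** (V ** R t))"
        by (simp add: matrix_mul_assoc)
      also have "\<dots> = trace (V ** (R t ** A ** ((A - mat 1) ** R t)))"
        by (subst trace_mul_sym) (simp add: matrix_mul_assoc)
      also have "R t ** A ** ((A - mat 1) ** R t) = A ** (R t ** (A - mat 1) ** R t)"
        by (simp add: matrix_mul_assoc R_A)
      finally show ?thesis .
    qed
    ultimately show ?thesis
      by (simp add: R_A linear_add linear_diff linear_scale bounded_linear.linear[OF bounded_linear_trace]
          matmul.add_right matmul.diff_right matmul.scaleR_right matmul.scaleR_left)
  qed
  show ?thesis by (rule trans[OF integral_cong int]) (rule eq)
qed

text \<open>The pairs \<open>(e, t)\<close> with nonsingular segment form an open set containing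
  \<open>{0} \<times> {0..1}\<close>; by compactness of \<open>{0..1}\<close> one \<open>d\<close>
  serves all \<open>t\<close>.\<close>

lemma slit_spectrum_line_nbhd:
  assumes "slit_spectrum A"
  obtains d where "d > 0" "\<And>e. e \<in> ball 0 d \<Longrightarrow> slit_spectrum (A + e *\<^sub>R V)"
proof -
  define W where "W = {p :: real \<times> real. det (mat_segment (A + fst p *\<^sub>R V) (snd p)) \<noteq> 0}"
  have "open W"
    unfolding W_def mat_segment_def
    by (intro open_Collect_neq continuous_on_det continuous_intros)
  moreover have "{0} \<times> {0..1} \<subseteq> W"
    using invertible_mat_segment[OF assms] by (auto simp: W_def invertible_det_nz)
  ultimately obtain X where "0 \<in> X" "open X" "X \<times> {0..1} \<subseteq> W"
    using Elementary_Topology.tube_lemma[of "{0..1 :: real}" W 0] by auto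
  then obtain d where d: "d > 0" "ball 0 d \<subseteq> X"
    using open_contains_ball by blast
  have "slit_spectrum (A + e *\<^sub>R V)" if "e \<in> ball 0 d" for e
    unfolding slit_spectrum_iff_invertible_segment
    using that d(2) \<open>X \<times> {0..1} \<subseteq> W\<close> by (force simp: W_def invertible_det_nz)
  with d(1) that show ?thesis by blast
qed

text \<open>The Leibniz rule applies because the derivative \<open>f'\<close> of the integrand is
  jointly continuous in \<open>e\<close> and \<open>t\<close>; the integral of \<open>f' 0\<close>
  is the trace identity above.\<close>

lemma trace_mult_log_integral_has_vector_derivative:
  assumes slit: "slit_spectrum A"
  shows "((\<lambda>e. trace ((A + e *\<^sub>R V) ** log_integral (A + e *\<^sub>R V))) has_vector_derivative
    trace (V ** (log_integral A + mat 1))) (at 0)"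
proof -
  obtain d where d: "d > 0" and slit': "\<And>e. e \<in> ball 0 d \<Longrightarrow> slit_spectrum (A + e *\<^sub>R V)"
    using slit_spectrum_line_nbhd[OF slit, where V = V] by blast
  define U :: "real set" where "U = ball 0 d"
  define M where "M e = A + e *\<^sub>R V" for e :: real
  define R where "R e t = matrix_inv (mat_segment (M e) t)" for e t
  define f where "f e t = trace (M e ** ((M e - mat 1) ** R e t))" for e t
  define f' where "f' e t = trace (V ** ((M e - mat 1) ** R e t) + M e ** (V ** R e t)
      - M e ** ((M e - mat 1) ** (R e t ** (t *\<^sub>R V) ** R e t)))" for e t
  have inv: "invertible (mat_segment (M e) t)" if "e \<in> U" "t \<in> {0..1}" for e t
    using that slit' by (auto intro!: invertible_mat_segment simp: U_def M_def)
  \<comment> \<open>For fixed \<open>t\<close> the segment is affine in \<open>e\<close> with slope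
    \<open>t V\<close>, the form in which the inverse was differentiated.\<close>
  have seg: "mat_segment (M e) t = (mat 1 + t *\<^sub>R (A - mat 1)) + e *\<^sub>R (t *\<^sub>R V)" for e t
    by (simp add: mat_segment_def M_def algebra_simps)
  have trace_integral: "trace (M e ** log_integral (M e)) = integral {0..1} (f e)" if "e \<in> U" for e
    unfolding f_def R_def
    using that slit' bounded_linear_compose[OF bounded_linear_trace matmul.bounded_linear_right]
    by (intro bounded_linear_log_integral) (auto simp: U_def M_def)
  have deriv: "((\<lambda>e. f e t) has_vector_derivative f' e t) (at e within U)" if "e \<in> U" "t \<in> cbox 0 1" for e t
  proof -
    have M: "(M has_vector_derivative V) (at e within U)"
      unfolding M_def by (auto intro!: derivative_eq_intros)
    then have M1: "((\<lambda>e. M e - mat 1) has_vector_derivative V) (at e within U)"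
      by (simp add: has_vector_derivative_diff_const)
    have R: "((\<lambda>e. R e t) has_vector_derivative - (R e t ** (t *\<^sub>R V) ** R e t)) (at e within U)"
      unfolding R_def seg using inv that by (intro matrix_inv_has_vector_derivative) (auto simp: seg)
    from bounded_linear.has_vector_derivative[OF bounded_linear_trace
        matmul.has_vector_derivative[OF M matmul.has_vector_derivative[OF M1 R]]]
    show ?thesis
      by (simp add: f_def f'_def matmul.minus_right matmul.diff_right algebra_simps)
  qed
  have cont: "continuous_on (U \<times> cbox 0 1) (\<lambda>(e, t). f' e t)"
  proof -
    have "continuous_on (U \<times> cbox 0 1) (\<lambda>p. R (fst p) (snd p))"
      unfolding R_def
    proof (rule continuous_on_matrix_inv)
      show "continuous_on (U \<times> cbox 0 1) (\<lambda>p. mat_segment (M (fst p)) (snd p))"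
        unfolding seg by (intro continuous_intros)
    qed (use inv in auto)
    then show ?thesis
      unfolding f'_def case_prod_unfold M_def
      by (intro bounded_linear.continuous_on[OF bounded_linear_trace] continuous_intros matmul.continuous_on)
  qed
  have f_int: "f e integrable_on cbox 0 1" if "e \<in> U" for e
  proof -
    have "continuous_on {0..1} (R e)"
      unfolding R_def using that slit' by (intro continuous_on_inv_segment) (auto simp: U_def M_def)
    then show ?thesis
      unfolding f_def cbox_interval
      by (intro integrable_continuous_real bounded_linear.continuous_on[OF bounded_linear_trace]
          continuous_intros matmul.continuous_on)
  qed
  have "0 \<in> U" using d by (simp add: U_def)
  then have "((\<lambda>e. integral (cbox 0 1) (f e)) has_vector_derivative integral (cbox 0 1) (f' 0)) (at 0 within U)"
    using deriv f_int cont by (intro leibniz_rule_vector_derivative[where fx = f']) (auto simp: U_def)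
  moreover have "integral (cbox 0 1) (f' 0) = trace (V ** (log_integral A + mat 1))"
    using trace_mult_log_integrand_integral[OF slit, of V] by (simp add: f'_def[abs_def] R_def M_def)
  ultimately have "((\<lambda>e. integral {0..1} (f e)) has_vector_derivative trace (V ** (log_integral A + mat 1))) (at 0)"
    using \<open>0 \<in> U\<close> by (simp add: U_def at_within_open[of _ "ball 0 d"])
  then show ?thesis
    by (rule has_vector_derivative_transform_within_open[where S = U])
      (use \<open>0 \<in> U\<close> trace_integral in \<open>auto simp: U_def M_def\<close>)
qed

lemma von_Neumann_has_vector_derivative:
  assumes slit: "slit_spectrum A"
  shows "((\<lambda>e. von_Neumann (A + e *\<^sub>R V)) has_vector_derivative trace (matrix_Log A ** V)) (at 0)"
proof -
  obtain d where d: "d > 0" and slit': "\<And>e. e \<in> ball 0 d \<Longrightarrow> slit_spectrum (A + e *\<^sub>R V)"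
    using slit_spectrum_line_nbhd[OF slit, where V = V] by blast
  have "((\<lambda>e. A + e *\<^sub>R V) has_vector_derivative V) (at 0)"
    by (auto intro!: derivative_eq_intros)
  from has_vector_derivative_diff[OF trace_mult_log_integral_has_vector_derivative[OF slit, of V]
      bounded_linear.has_vector_derivative[OF bounded_linear_trace this]]
  have "((\<lambda>e. trace ((A + e *\<^sub>R V) ** log_integral (A + e *\<^sub>R V)) - trace (A + e *\<^sub>R V))
      has_vector_derivative trace (log_integral A ** V)) (at 0)"
    by (simp add: matmul.add_right trace_add trace_mul_sym[of V])
  \<comment> \<open>\<open>matrix_Log\<close> is identified with the integral under the spectral
    condition, so the two functions are compared on the ball alone.\<close>
  then have "((\<lambda>e. von_Neumann (A + e *\<^sub>R V)) has_vector_derivative trace (log_integral A ** V)) (at 0)"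
    by (rule has_vector_derivative_transform_within_open[where S = "ball 0 d"])
      (use d slit' in \<open>auto simp: von_Neumann_def trace_sub matrix_Log_eq_log_integral\<close>)
  then show ?thesis by (simp add: matrix_Log_eq_log_integral slit)
qed

section \<open>Uniqueness and value of the gradient\<close>

lemma ctranspose_ctranspose [simp]: "ctranspose (ctranspose A) = A"
  by (simp add: ctranspose_def vec_eq_iff)

lemma frob_inner_matrix_unit:
  "frob_inner G (\<chi> r c. if r = i \<and> c = j then 1 else 0) = cnj (G $ i $ j)"
proof -
  have "x * (if P \<and> Q then 1 else 0) = (if P then if Q then x else 0 else 0)" for x :: complex and P Q
    by simp
  then show ?thesis
    by (simp add: frob_inner_def trace_def matrix_matrix_mult_def ctranspose_def)
qed

text \<open>Matrix units have entries \<open>0\<close> and \<open>1\<close>, so they are admissible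
  directions over \<open>K\<close>; testing against them recovers every entry of a gradient.\<close>

lemma gradient_eqI:
  assumes K: "0 \<in> K" "1 \<in> K" and G: "G \<in> mats_over K"
    and deriv: "\<And>V. V \<in> mats_over K \<Longrightarrow>
      ((\<lambda>\<epsilon>::real. F (A + \<epsilon> *\<^sub>R V)) has_vector_derivative frob_inner G V) (at 0)"
  shows "gradient K F A = G"
  unfolding gradient_def
proof (rule the_equality)
  fix H assume H: "H \<in> mats_over K \<and> (\<forall>V\<in>mats_over K.
      ((\<lambda>\<epsilon>. F (A + \<epsilon> *\<^sub>R V)) has_vector_derivative frob_inner H V) (at 0))"
  have "cnj (H $ i $ j) = cnj (G $ i $ j)" for i j
  proof -
    let ?V = "\<chi> r c. if r = i \<and> c = j then 1 else 0"
    have "?V \<in> mats_over K" using K by (simp add: mats_over_def)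
    then have "frob_inner H ?V = frob_inner G ?V"
      using H deriv vector_derivative_unique_at by blast
    then show ?thesis by (simp only: frob_inner_matrix_unit)
  qed
  then show "H = G" by (simp add: vec_eq_iff)
qed (use G deriv in blast)

text \<open>Since \<open>frob_inner (ctranspose L) V\<close> is \<open>trace (L ** V)\<close>, the
  derivative found above is already in gradient form.\<close>

lemma gradient_von_Neumann:
  assumes K: "K = \<real> \<or> K = UNIV" and A: "A \<in> Log_domain K"
  shows "gradient K von_Neumann A = ctranspose (matrix_Log A)"
proof (rule gradient_eqI)
  have slit: "slit_spectrum A" and "A \<in> mats_over K"
    using A by (auto simp: Log_domain_def slit_spectrum_def)
  then have "matrix_Log A \<in> mats_over K"
    using K log_integral_in_mats_over_Reals[of A]
    by (auto simp: matrix_Log_eq_log_integral) (simp add: mats_over_def)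
  then show "ctranspose (matrix_Log A) \<in> mats_over K"
    using K by (auto simp: mats_over_def ctranspose_def complex_is_Real_iff)
  show "((\<lambda>\<epsilon>. von_Neumann (A + \<epsilon> *\<^sub>R V)) has_vector_derivative
      frob_inner (ctranspose (matrix_Log A)) V) (at 0)" for V
    using von_Neumann_has_vector_derivative[OF slit] by (simp add: frob_inner_def)
qed (use K in auto)

theorem proposition4:
  fixes K :: "complex set" and X Y :: "complex ^ 'n ^ 'n"
  assumes "K = \<real> \<or> K = UNIV"
    and "X \<in> Log_domain K" and "Y \<in> Log_domain K"
  shows "total_bregman_divergence K von_Neumann X Y =
    trace (X ** (matrix_Log X - matrix_Log Y) - X + Y) /
      complex_of_real (sqrt (1 + (frob_norm (ctranspose (matrix_Log Y)))\<^sup>2))"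
proof -
  \<comment> \<open>After cyclic permutation the two terms \<open>trace (Y Log Y)\<close>
    cancel.\<close>
  have "von_Neumann X - von_Neumann Y - frob_inner (ctranspose (matrix_Log Y)) (X - Y)
      = trace (X ** (matrix_Log X - matrix_Log Y) - X + Y)"
    by (simp add: von_Neumann_def frob_inner_def matmul.diff_right trace_add trace_sub
        trace_mul_sym[of "matrix_Log Y"])
  then show ?thesis
    by (simp add: total_bregman_divergence_def gradient_von_Neumann[OF assms(1,3)])
qed

end
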